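(* Let $X$ be a real Hilbert space with dual $X'$, let $F:X\to X'$ be a (nonlinear) operator, and for each $u\in X$ let $A(u):X\to X'$ be linear and invertible, with associated bilinear form $a(u;v,w):=\langle A(u)v,w\rangle$. Suppose that: (i) there is $\nu>0$ with $\nu\|u-v\|_X^2\le\langle F(u)-F(v),u-v\rangle$ for all $u,v\in X$; (ii) there are constants $\alpha,\beta>0$ independent of $u$ such that $a(u;v,v)\ge\alpha\|v\|_X^2$ and $a(u;v,w)\le\beta\|v\|_X\|w\|_X$ for all $u,v,w\in X$; (iii) the mappings $u\mapsto a(u;u,\cdot)$ and $u\mapsto F(u)$ are continuous from $X$ (with the norm topology) into $X'$ endowed with the weak topology. Let $u^0\in X$ and let $\{u^n\}_{n\ge0}\subset X$ be the sequence defined by $$A(u^n)u^{n+1}=f(u^n)\quad\text{in }X',\qquad n\ge0,\qquad\text{where } f(u):=A(u)u-F(u).$$ If $\|u^{n+1}-u^n\|_X\to0$ as $n\to\infty$, then $\{u^n\}_{n\ge 0}$ converges (in $X$) to the unique solution $u^\star\in X$ of $F(u^\star)=0$ in $X'$.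
   Context: $\langle\cdot,\cdot\rangle$ denotes the duality pairing in $X'\times X$, and $\|\cdot\|_X$ the norm induced by the inner product of $X$. *)

theory Defs
  imports "HOL-Analysis.Analysis"
begin

text \<open>The dual of \<^typ>\<open>'a\<close> is \<^typ>\<open>'a \<Rightarrow>\<^sub>L real\<close>, and the duality pairing of \<open>\<phi>\<close> with \<open>v\<close> is
  \<^term>\<open>blinfun_apply \<phi> v\<close>.\<close>

text \<open>The weak topology of a normed space: the coarsest one making every bounded linear
  functional continuous. On a dual space this ranges over the whole bidual and so is, in general,
  finer than the weak-* topology; the two agree on the dual of a Hilbert space.\<close>

definition weak_topology :: "'b::real_normed_vector topology" where
  "weak_topology =
     topology_generated_by {blinfun_apply \<phi> -` U | (\<phi> :: 'b \<Rightarrow>\<^sub>L real) U. open U}"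

lemma topspace_weak_topology [simp]:
  "topspace (weak_topology :: 'b::real_normed_vector topology) = UNIV"
proof -
  have "UNIV \<in> {blinfun_apply \<phi> -` U | (\<phi> :: 'b \<Rightarrow>\<^sub>L real) U. open U}"
    by (metis (mono_tags, lifting) mem_Collect_eq open_UNIV vimage_UNIV)
  then show ?thesis
    unfolding weak_topology_def topology_generated_by_topspace by blast
qed

lemma continuous_map_weak_topology_iff:
  fixes g :: "'a::topological_space \<Rightarrow> 'b::real_normed_vector"
  shows "continuous_map euclidean weak_topology g \<longleftrightarrow>
    (\<forall>\<phi> :: 'b \<Rightarrow>\<^sub>L real. continuous_on UNIV (\<lambda>x. blinfun_apply \<phi> (g x)))"
proof
  assume g: "continuous_map euclidean weak_topology g"
  show "\<forall>\<phi> :: 'b \<Rightarrow>\<^sub>L real. continuous_on UNIV (\<lambda>x. blinfun_apply \<phi> (g x))"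
  proof
    fix \<phi> :: "'b \<Rightarrow>\<^sub>L real"
    have "open ((\<lambda>x. blinfun_apply \<phi> (g x)) -` U)" if "open U" for U
    proof -
      have "openin weak_topology (blinfun_apply \<phi> -` U)"
        unfolding weak_topology_def using that by (intro topology_generated_by_Basis) auto
      from openin_continuous_map_preimage[OF g this] show ?thesis
        by (simp add: vimage_def)
    qed
    then show "continuous_on UNIV (\<lambda>x. blinfun_apply \<phi> (g x))"
      by (simp add: continuous_on_open_vimage)
  qed
next
  assume g: "\<forall>\<phi> :: 'b \<Rightarrow>\<^sub>L real. continuous_on UNIV (\<lambda>x. blinfun_apply \<phi> (g x))"
  show "continuous_map euclidean weak_topology g"
    unfolding weak_topology_def
  proof (rule continuous_on_generated_topo)
    fix U assume "U \<in> {blinfun_apply \<phi> -` U | (\<phi> :: 'b \<Rightarrow>\<^sub>L real) U. open U}"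
    then obtain \<phi> :: "'b \<Rightarrow>\<^sub>L real" and V where "U = blinfun_apply \<phi> -` V" "open V" by auto
    with g show "openin euclidean (g -` U \<inter> topspace euclidean)"
      by (simp add: continuous_on_open_vimage vimage_def)
  next
    show "g ` topspace euclidean \<subseteq> \<Union> {blinfun_apply \<phi> -` U | (\<phi> :: 'b \<Rightarrow>\<^sub>L real) U. open U}"
      using topspace_weak_topology
      unfolding weak_topology_def topology_generated_by_topspace by blast
  qed
qed

definition assoc_form ::
  "('a::real_normed_vector \<Rightarrow> 'a \<Rightarrow> ('a \<Rightarrow>\<^sub>L real)) \<Rightarrow> 'a \<Rightarrow> 'a \<Rightarrow> 'a \<Rightarrow> real" where
  "assoc_form A u v w = blinfun_apply (A u v) w"

definition iter_rhs ::
  "('a::real_normed_vector \<Rightarrow> 'a \<Rightarrow> ('a \<Rightarrow>\<^sub>L real)) \<Rightarrow> ('a \<Rightarrow> ('a \<Rightarrow>\<^sub>L real)) \<Rightarrow> 'a \<Rightarrow> ('a \<Rightarrow>\<^sub>L real)"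
  where "iter_rhs A F u = A u u - F u"

end

theory Submission
  imports Defs
begin

text \<open>The iteration satisfies \<open>F (u n) = A (u n) (u n - u (Suc n))\<close>: the residual is the form
  \<open>A (u n)\<close> applied to the increment. By the uniform bound on the forms, \<open>F (u n)\<close> therefore tends
  to zero in the norm of the dual. Strong monotonicity makes \<open>F\<close> expansive,
  \<open>\<nu> * norm (v - w) \<le> norm (F v - F w)\<close>, so convergence of the residuals forces the iterates to be a
  Cauchy sequence. The limit is a zero of \<open>F\<close>, because \<open>F\<close> is continuous into the weak topology
  and the residuals have limit zero; expansiveness again makes this zero unique. Thus
  the existence of the zero is itself obtained as the limit of the iteration.\<close>

text \<open>Cauchy--Schwarz for the duality pairing, then cancellation of one factor \<open>norm (v - w)\<close>.\<close>

lemma strongly_monotone_imp_expansive: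
  fixes F :: "'a::real_normed_vector \<Rightarrow> ('a \<Rightarrow>\<^sub>L real)"
  assumes "\<nu> * (norm (v - w))\<^sup>2 \<le> blinfun_apply (F v - F w) (v - w)"
  shows "\<nu> * norm (v - w) \<le> norm (F v - F w)"
proof (cases "v = w")
  case False
  have "\<nu> * norm (v - w) * norm (v - w) \<le> blinfun_apply (F v - F w) (v - w)"
    using assms by (simp add: power2_eq_square mult.assoc)
  also have "\<dots> \<le> norm (blinfun_apply (F v - F w) (v - w))"
    by simp
  also have "\<dots> \<le> norm (F v - F w) * norm (v - w)"
    by (rule norm_blinfun)
  finally show ?thesis
    using False by (simp add: mult_le_cancel_right)
qed simp

lemma Cauchy_if_expansive_image_Cauchy:
  fixes F :: "'a::real_normed_vector \<Rightarrow> 'b::real_normed_vector"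
  assumes "\<nu> > 0"
    and expansive: "\<And>v w. \<nu> * norm (v - w) \<le> norm (F v - F w)"
    and Cauchy: "Cauchy (\<lambda>n. F (u n))"
  shows "Cauchy u"
proof (rule CauchyI)
  fix e :: real
  assume "e > 0"
  with \<open>\<nu> > 0\<close> obtain M where M: "norm (F (u m) - F (u n)) < \<nu> * e" if "m \<ge> M" "n \<ge> M" for m n
    using CauchyD [OF Cauchy, of "\<nu> * e"] by auto
  have "norm (u m - u n) < e" if "m \<ge> M" "n \<ge> M" for m n
    using le_less_trans [OF expansive M [OF that]] \<open>\<nu> > 0\<close> by simp
  then show "\<exists>M. \<forall>m\<ge>M. \<forall>n\<ge>M. norm (u m - u n) < e"
    by blast
qed

text \<open>A one-sided bound on all of the space is two-sided, since the vector may be replaced by its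
  negative; so it controls the dual norm.\<close>

lemma norm_blinfun_le_if_upper_bound:
  fixes \<phi> :: "'a::real_normed_vector \<Rightarrow>\<^sub>L real"
  assumes "b \<ge> 0" and upper: "\<And>w. blinfun_apply \<phi> w \<le> b * norm w"
  shows "norm \<phi> \<le> b"
proof (rule norm_blinfun_bound [OF \<open>b \<ge> 0\<close>])
  fix w
  show "norm (blinfun_apply \<phi> w) \<le> b * norm w"
    using upper [of w] upper [of "- w"] by (simp add: blinfun.minus_right abs_le_iff)
qed

text \<open>Evaluation at a fixed vector is an element of the bidual, so weak convergence in the dual
  implies pointwise convergence; this is the form in which weak continuity is used.\<close>

lemma weak_continuous_imp_tendsto_apply:
  fixes F :: "'a::topological_space \<Rightarrow> ('b::real_normed_vector \<Rightarrow>\<^sub>L real)"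
  assumes F: "continuous_map euclidean weak_topology F"
    and u: "u \<longlonglongrightarrow> x"
  shows "(\<lambda>n. blinfun_apply (F (u n)) v) \<longlonglongrightarrow> blinfun_apply (F x) v"
proof -
  define ev :: "('b \<Rightarrow>\<^sub>L real) \<Rightarrow>\<^sub>L real" where "ev = Blinfun (\<lambda>\<psi>. blinfun_apply \<psi> v)"
  have ev: "blinfun_apply ev \<psi> = blinfun_apply \<psi> v" for \<psi>
    unfolding ev_def by (simp add: bounded_linear_Blinfun_apply blinfun.bounded_linear_left)
  have "continuous_on UNIV (\<lambda>y. blinfun_apply ev (F y))"
    using F unfolding continuous_map_weak_topology_iff by blast
  then show ?thesis
    using continuous_on_tendsto_compose [OF _ u] by (fastforce simp: ev)
qed

theorem proposition2p1:
  fixes F :: "'a::{real_inner,complete_space} \<Rightarrow> ('a \<Rightarrow>\<^sub>L real)"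
    and A :: "'a \<Rightarrow> 'a \<Rightarrow> ('a \<Rightarrow>\<^sub>L real)"
    and \<nu> \<alpha> \<beta> :: real
    and u :: "nat \<Rightarrow> 'a"
    and u0 :: 'a
  assumes A_linear: "\<And>v. linear (A v)"
    and A_invertible: "\<And>v. bij (A v)"
    and nu_pos: "\<nu> > 0"
    and F_strongly_monotone:
      "\<And>v w. \<nu> * (norm (v - w))\<^sup>2 \<le> blinfun_apply (F v - F w) (v - w)"
    and alpha_pos: "\<alpha> > 0"
    and beta_pos: "\<beta> > 0"
    and coercive: "\<And>z v. assoc_form A z v v \<ge> \<alpha> * (norm v)\<^sup>2"
    and bounded: "\<And>z v w. assoc_form A z v w \<le> \<beta> * norm v * norm w"
    and A_continuous: "continuous_map euclidean weak_topology (\<lambda>v. A v v)"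
    and F_continuous: "continuous_map euclidean weak_topology F"
    and initial: "u 0 = u0"
    and iteration: "\<And>n. A (u n) (u (Suc n)) = iter_rhs A F (u n)"
    and increments: "(\<lambda>n. norm (u (Suc n) - u n)) \<longlonglongrightarrow> 0"
  shows "(\<exists>!x. F x = 0) \<and> u \<longlonglongrightarrow> (THE x. F x = 0)"
proof -
  have expansive: "\<nu> * norm (v - w) \<le> norm (F v - F w)" for v w
    by (rule strongly_monotone_imp_expansive) (rule F_strongly_monotone)
  have residual: "F (u n) = A (u n) (u n - u (Suc n))" for n
    using iteration [of n] by (simp add: iter_rhs_def linear_diff [OF A_linear])
  have "norm (A z v) \<le> \<beta> * norm v" for z v
    using beta_pos bounded [of z v]
    by (intro norm_blinfun_le_if_upper_bound) (simp_all add: assoc_form_def)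
  then have residual_le: "norm (F (u n)) \<le> \<beta> * norm (u (Suc n) - u n)" for n
    by (metis residual norm_minus_commute)
  have residual_tendsto: "(\<lambda>n. F (u n)) \<longlonglongrightarrow> 0"
  proof (rule Lim_null_comparison)
    show "\<forall>\<^sub>F n in sequentially. norm (F (u n)) \<le> \<beta> * norm (u (Suc n) - u n)"
      using residual_le by simp
    show "(\<lambda>n. \<beta> * norm (u (Suc n) - u n)) \<longlonglongrightarrow> 0"
      using tendsto_mult_right_zero [OF increments] .
  qed
  have "Cauchy u"
    using nu_pos expansive LIMSEQ_imp_Cauchy [OF residual_tendsto]
    by (rule Cauchy_if_expansive_image_Cauchy)
  then obtain x where x: "u \<longlonglongrightarrow> x"
    using Cauchy_convergent convergent_def by blast
  have "F x = 0"
  proof (rule blinfun_eqI)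
    fix v
    have "(\<lambda>n. blinfun_apply (F (u n)) v) \<longlonglongrightarrow> blinfun_apply 0 v"
      by (intro tendsto_intros residual_tendsto)
    with weak_continuous_imp_tendsto_apply [OF F_continuous x]
    show "blinfun_apply (F x) v = blinfun_apply 0 v"
      by (rule LIMSEQ_unique)
  qed
  moreover have "y = x" if "F y = 0" for y
    using expansive [of y x] that \<open>F x = 0\<close> nu_pos by (simp add: mult_le_0_iff)
  ultimately have "\<exists>!x. F x = 0" and "(THE x. F x = 0) = x"
    by blast+
  with x show ?thesis
    by simp
qed

end
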